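(* Every Jordan loop of order $5$ is a cyclic group.
   Context: A loop is a quasigroup (a magma in which $ax=b$ and $ya=b$ have unique solutions for all $a,b$) with a neutral element. A loop is Jordan if it is commutative and satisfies $x^2(yx)=(x^2y)x$. *)

theory Defs
  imports "HOL-Algebra.Elementary_Groups"
begin

(* HOL-Algebra has no locale below monoid, so the underlying magma is given by
   carrier and multiplication of a monoid record; quasigroup does not mention
   the unit field. *)
locale quasigroup =
  fixes G (structure)
  assumes m_closed [intro, simp]:
      "\<lbrakk>x \<in> carrier G; y \<in> carrier G\<rbrakk> \<Longrightarrow> x \<otimes> y \<in> carrier G"
    and left_division:
      "\<lbrakk>a \<in> carrier G; b \<in> carrier G\<rbrakk> \<Longrightarrow> \<exists>!x. x \<in> carrier G \<and> a \<otimes> x = b"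
    and right_division:
      "\<lbrakk>a \<in> carrier G; b \<in> carrier G\<rbrakk> \<Longrightarrow> \<exists>!y. y \<in> carrier G \<and> y \<otimes> a = b"

locale loop = quasigroup +
  assumes one_closed [intro, simp]: "\<one> \<in> carrier G"
    and l_one [simp]: "x \<in> carrier G \<Longrightarrow> \<one> \<otimes> x = x"
    and r_one [simp]: "x \<in> carrier G \<Longrightarrow> x \<otimes> \<one> = x"

locale jordan_loop = loop +
  assumes m_comm: "\<lbrakk>x \<in> carrier G; y \<in> carrier G\<rbrakk> \<Longrightarrow> x \<otimes> y = y \<otimes> x"
    and jordan: "\<lbrakk>x \<in> carrier G; y \<in> carrier G\<rbrakk> \<Longrightarrow>
      (x \<otimes> x) \<otimes> (y \<otimes> x) = ((x \<otimes> x) \<otimes> y) \<otimes> x"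

end

theory Submission
  imports Defs
begin

text \<open>
  In a commutative loop of order 5 no \<open>a \<noteq> 1\<close> squares to 1. Put \<open>b = a\<^sup>2\<close> and \<open>c = ab\<close>.
  The Jordan identity with \<open>y = x = a\<close> gives \<open>b\<^sup>2 = ac\<close>, so \<open>c = 1\<close> would make \<open>{1, a, b}\<close> a
  subloop of more than half the order, which is impossible. Hence \<open>1, a, b, c\<close> are distinct, and
  the Latin square property forces the remaining entries to be those of the cyclic group.
\<close>

lemma (in quasigroup) l_cancel:
  assumes "x \<in> carrier G" "y \<in> carrier G" "z \<in> carrier G"
  shows "x \<otimes> y = x \<otimes> z \<longleftrightarrow> y = z"
  using left_division[of x "x \<otimes> z"] assms m_closed by metis

text \<open>Cancellation against \<open>x \<otimes> \<one>\<close>. Together with its mirror image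
  below, it bars both factors as values of a product of non-identity elements.\<close>

lemma (in loop) mult_eq_left_iff:
  assumes "x \<in> carrier G" "y \<in> carrier G"
  shows "x \<otimes> y = x \<longleftrightarrow> y = \<one>"
  using l_cancel[of x y \<one>] assms by simp

lemma (in loop) mult_eq_right_iff:
  assumes "x \<in> carrier G" "y \<in> carrier G"
  shows "x \<otimes> y = y \<longleftrightarrow> x = \<one>"
  using right_division[of y y] assms one_closed l_one by metis

context jordan_loop
begin

text \<open>Otherwise translation by \<open>a\<close> permutes the other three elements cyclically.
  A product of two distinct members of this cycle can only be \<open>\<one>\<close> or
  \<open>a\<close>, yet the three such products are pairwise different by cancellation, which
  contradicts the pigeonhole principle.\<close>

lemma square_neq_one_order_5:
  assumes carrier: "carrier G = {\<one>, a, b, c, d}" and distinct: "distinct [\<one>, a, b, c, d]"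
  shows "a \<otimes> a \<noteq> \<one>"
proof
  assume aa: "a \<otimes> a = \<one>"
  \<comment> \<open>Translation by \<open>a\<close> swaps \<open>\<one>\<close> and \<open>a\<close> and has no fixed points, so it is a 3-cycle
    on the rest.\<close>
  have impossible: False
    if C: "carrier G = {\<one>, a, x, y, z}" and D: "distinct [\<one>, a, x, y, z]" and ax: "a \<otimes> x = y"
    for x y z
  proof -
    have mem: "a \<in> carrier G" "x \<in> carrier G" "y \<in> carrier G" "z \<in> carrier G"
      using C by auto
    note facts = mem D aa ax
    have mult_cases: "u \<otimes> v \<in> {\<one>, a, x, y, z}" if "u \<in> carrier G" "v \<in> carrier G" for u v
      using m_closed[OF that] C by simp
    have az: "a \<otimes> z = x"
      using mult_cases[of a z] facts l_cancel[of a z x] l_cancel[of a z a]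
        mult_eq_left_iff[of a z] mult_eq_right_iff[of a z] by auto
    have ay: "a \<otimes> y = z"
      using mult_cases[of a y] facts az l_cancel[of a y z] l_cancel[of a y a]
        mult_eq_left_iff[of a y] mult_eq_right_iff[of a y] by auto
    \<comment> \<open>The cycle is arbitrary here so that it can be rotated. The value
      \<open>w = v \<otimes> a\<close> for \<open>u \<otimes> v\<close> would force
      \<open>u = a\<close>, and the value \<open>v = u \<otimes> a\<close> for
      \<open>u \<otimes> w\<close> would force \<open>w = a\<close>.\<close>
    have rot: "u \<otimes> v \<in> {\<one>, a} \<and> u \<otimes> w \<in> {\<one>, a}"
      if "a \<otimes> u = v" "a \<otimes> v = w" "a \<otimes> w = u"
        "carrier G = {\<one>, a, u, v, w}" "distinct [\<one>, a, u, v, w]" for u v w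
    proof -
      have m: "u \<in> carrier G" "v \<in> carrier G" "w \<in> carrier G" "a \<in> carrier G"
        using that by auto
      have cm: "u \<otimes> a = v" "v \<otimes> a = w" "w \<otimes> a = u"
        using that m_comm m by auto
      have uv: "u \<otimes> v \<in> {\<one>, a}"
        using m_closed[of u v] that m mult_eq_left_iff[of u v] mult_eq_right_iff[of u v]
          m_comm[of u v] l_cancel[of v u a] cm by auto
      have uw: "u \<otimes> w \<in> {\<one>, a}"
        using m_closed[of u w] that m mult_eq_left_iff[of u w] mult_eq_right_iff[of u w]
          l_cancel[of u w a] cm by auto
      show ?thesis
        using uv uw by blast
    qed
    have xr: "x \<otimes> y \<in> {\<one>, a}" "x \<otimes> z \<in> {\<one>, a}"
      using rot[of x y z] C D ax ay az by auto
    have yr: "y \<otimes> z \<in> {\<one>, a}"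
      using rot[of y z x] C D ax ay az by (auto simp: insert_commute)
    have "x \<otimes> y \<noteq> x \<otimes> z" "y \<otimes> x \<noteq> y \<otimes> z" "z \<otimes> x \<noteq> z \<otimes> y"
      using D mem l_cancel by auto
    then show False
      using xr yr m_comm mem by auto
  qed
  \<comment> \<open>The two cases differ only by exchanging the names \<open>c\<close> and
    \<open>d\<close>.\<close>
  have "a \<otimes> b \<in> {c, d}"
    using m_closed[of a b] carrier distinct aa l_cancel[of a b a]
      mult_eq_left_iff[of a b] mult_eq_right_iff[of a b] by auto
  then show False
    using impossible[of b c d] impossible[of b d c] carrier distinct
    by (auto simp: insert_commute)
qed

text \<open>This is the table of the integers modulo 5, with \<open>\<one>, a, b, c, d\<close> in
  the roles of 0 to 4. Commutativity supplies the other half.\<close>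

lemma multiplication_table_order_5:
  assumes "order G = 5"
  obtains a b c d where "carrier G = {\<one>, a, b, c, d}" "distinct [\<one>, a, b, c, d]"
    "a \<otimes> a = b" "a \<otimes> b = c" "a \<otimes> c = d" "a \<otimes> d = \<one>"
    "b \<otimes> b = d" "b \<otimes> c = \<one>" "b \<otimes> d = a" "c \<otimes> c = a" "c \<otimes> d = b" "d \<otimes> d = c"
proof -
  have card: "card (carrier G) = 5" and fin: "finite (carrier G)"
    using assms by (auto simp: order_def intro: card_ge_0_finite)
  \<comment> \<open>Provides fresh elements one at a time. Repetitions in \<open>xs\<close> are
    harmless, as the set has at most \<open>length xs\<close> elements.\<close>
  have extend: "\<exists>y. y \<in> carrier G \<and> y \<notin> set xs" if "length xs < 5" for xs
  proof (rule ccontr)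
    assume "\<not> ?thesis"
    then have "card (carrier G) \<le> card (set xs)"
      by (intro card_mono) auto
    then show False
      using card card_length[of xs] that by simp
  qed
  have exhaust: "carrier G = set xs" if "distinct xs" "length xs = 5" "set xs \<subseteq> carrier G" for xs
    using card_subset_eq[OF fin that(3)] that card by (simp add: distinct_card)
  obtain a where a: "a \<in> carrier G" "a \<noteq> \<one>"
    using extend[of "[\<one>]"] by auto
  have sq: "a \<otimes> a \<noteq> \<one>"
  proof -
    obtain b where b: "b \<in> carrier G" "b \<notin> set [\<one>, a]" using extend[of "[\<one>, a]"] by auto
    obtain c where c: "c \<in> carrier G" "c \<notin> set [\<one>, a, b]" using extend[of "[\<one>, a, b]"] by auto
    obtain d where d: "d \<in> carrier G" "d \<notin> set [\<one>, a, b, c]"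
      using extend[of "[\<one>, a, b, c]"] by auto
    show ?thesis
      using square_neq_one_order_5[of a b c d] exhaust[of "[\<one>, a, b, c, d]"] a b c d by auto
  qed
  define b where "b = a \<otimes> a"
  have b: "b \<in> carrier G" "b \<noteq> \<one>" "b \<noteq> a" "a \<otimes> a = b"
    using a sq mult_eq_left_iff[of a a] by (auto simp: b_def)
  have ba: "b \<otimes> a = a \<otimes> b"
    using m_comm a b by simp
  have bb: "b \<otimes> b = a \<otimes> (a \<otimes> b)"
    using jordan[of a a] a b m_comm[of "a \<otimes> b" a] ba by simp
  have "a \<otimes> b \<noteq> \<one>"
  proof
    assume ab: "a \<otimes> b = \<one>"
    obtain c where c: "c \<in> carrier G" "c \<notin> set [\<one>, a, b]" using extend[of "[\<one>, a, b]"] by auto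
    obtain d where d: "d \<in> carrier G" "d \<notin> set [\<one>, a, b, c]"
      using extend[of "[\<one>, a, b, c]"] by auto
    have C: "carrier G = {\<one>, a, b, c, d}"
      using exhaust[of "[\<one>, a, b, c, d]"] a b c d by auto
    \<comment> \<open>Now \<open>b \<otimes> b = a\<close>, so multiplying
      \<open>\<one>, a, b\<close> by \<open>a\<close> or by \<open>b\<close> already yields all of
      \<open>\<one>, a, b\<close>. Hence both send \<open>c\<close> outside this set and, fixing
      nothing, to \<open>d\<close>.\<close>
    have "a \<otimes> c = d"
      using m_closed[of a c] a b c d ab C l_cancel[of a c a] l_cancel[of a c b]
        mult_eq_left_iff[of a c] mult_eq_right_iff[of a c] by auto
    moreover have "b \<otimes> c = d"
      using m_closed[of b c] a b c d ab ba bb C l_cancel[of b c a] l_cancel[of b c b]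
        mult_eq_left_iff[of b c] mult_eq_right_iff[of b c] by auto
    ultimately show False
      using l_cancel[of c a b] m_comm a b c by auto
  qed
  moreover define c where "c = a \<otimes> b"
  ultimately have c: "c \<in> carrier G" "c \<notin> {\<one>, a, b}" "a \<otimes> b = c"
    using a b mult_eq_left_iff[of a b] mult_eq_right_iff[of a b] by auto
  obtain d where d: "d \<in> carrier G" "d \<notin> set [\<one>, a, b, c]"
    using extend[of "[\<one>, a, b, c]"] by auto
  have C: "carrier G = {\<one>, a, b, c, d}"
    using exhaust[of "[\<one>, a, b, c, d]"] a b c d by auto
  note facts = a b c d C
  \<comment> \<open>The value \<open>b\<close> is taken by \<open>a \<otimes> a\<close>; next,
    \<open>c\<close> falls away because it is \<open>a \<otimes> b\<close>.\<close>
  have ad: "a \<otimes> d \<in> {\<one>, c}"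
    using m_closed[of a d] facts l_cancel[of a d a]
      mult_eq_left_iff[of a d] mult_eq_right_iff[of a d] by auto
  then have ad: "a \<otimes> d = \<one>"
    using l_cancel[of a d b] facts by auto
  have ac: "a \<otimes> c = d"
    using m_closed[of a c] facts ad l_cancel[of a c a] l_cancel[of a c d]
      mult_eq_left_iff[of a c] mult_eq_right_iff[of a c] by auto
  have bb: "b \<otimes> b = d"
    using bb ac c by simp
  have comm: "b \<otimes> a = c" "c \<otimes> a = d" "d \<otimes> a = \<one>" "c \<otimes> b = b \<otimes> c" "d \<otimes> b = b \<otimes> d" "d \<otimes> c = c \<otimes> d"
    using ac ad facts m_comm by auto
  \<comment> \<open>From here the order matters: each entry is the only value left by its factors
    and the known entries of its row and column.\<close>
  have bd: "b \<otimes> d = a"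
    using m_closed[of b d] facts bb comm l_cancel[of b d a] l_cancel[of d b a]
      mult_eq_left_iff[of b d] mult_eq_right_iff[of b d] by auto
  have bc: "b \<otimes> c = \<one>"
    using m_closed[of b c] facts bb bd comm l_cancel[of b c b] l_cancel[of b c d]
      mult_eq_left_iff[of b c] mult_eq_right_iff[of b c] by auto
  have cd: "c \<otimes> d = b"
    using m_closed[of c d] facts bd bc comm l_cancel[of d c b] l_cancel[of c d b]
      mult_eq_left_iff[of c d] mult_eq_right_iff[of c d] by auto
  have cc: "c \<otimes> c = a"
    using m_closed[of c c] facts bc cd comm l_cancel[of c c a] l_cancel[of c c b] l_cancel[of c c d]
      mult_eq_left_iff[of c c] by auto
  have dd: "d \<otimes> d = c"
    using m_closed[of d d] facts bd cd comm l_cancel[of d d a] l_cancel[of d d b] l_cancel[of d d c]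
      mult_eq_left_iff[of d d] by auto
  show thesis
    by (rule that[of a b c d]) (use facts ad ac bb bd bc cd cc dd in auto)
qed

end

theorem corollary5p4:
  fixes G :: "('a, 'b) monoid_scheme"
  assumes "jordan_loop G" and "order G = 5"
  shows "group G \<and> cyclic_group G"
proof -
  interpret jordan_loop G by fact
  obtain a b c d where C: "carrier G = {\<one>\<^bsub>G\<^esub>, a, b, c, d}"
    and table: "a \<otimes>\<^bsub>G\<^esub> a = b" "a \<otimes>\<^bsub>G\<^esub> b = c" "a \<otimes>\<^bsub>G\<^esub> c = d" "a \<otimes>\<^bsub>G\<^esub> d = \<one>\<^bsub>G\<^esub>"
      "b \<otimes>\<^bsub>G\<^esub> b = d" "b \<otimes>\<^bsub>G\<^esub> c = \<one>\<^bsub>G\<^esub>" "b \<otimes>\<^bsub>G\<^esub> d = a"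
      "c \<otimes>\<^bsub>G\<^esub> c = a" "c \<otimes>\<^bsub>G\<^esub> d = b" "d \<otimes>\<^bsub>G\<^esub> d = c"
    using multiplication_table_order_5[OF assms(2)] by metis
  have mem: "a \<in> carrier G" "b \<in> carrier G" "c \<in> carrier G" "d \<in> carrier G"
    using C by auto
  have comm: "b \<otimes>\<^bsub>G\<^esub> a = c" "c \<otimes>\<^bsub>G\<^esub> a = d" "d \<otimes>\<^bsub>G\<^esub> a = \<one>\<^bsub>G\<^esub>"
    "c \<otimes>\<^bsub>G\<^esub> b = \<one>\<^bsub>G\<^esub>" "d \<otimes>\<^bsub>G\<^esub> b = a" "d \<otimes>\<^bsub>G\<^esub> c = b"
    using table m_comm mem by auto
  \<comment> \<open>A finite check: the full table decides all 125 triples.\<close>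
  have assoc: "x \<otimes>\<^bsub>G\<^esub> y \<otimes>\<^bsub>G\<^esub> z = x \<otimes>\<^bsub>G\<^esub> (y \<otimes>\<^bsub>G\<^esub> z)"
    if "x \<in> carrier G" "y \<in> carrier G" "z \<in> carrier G" for x y z
    using that unfolding C by (elim insertE emptyE) (simp_all add: table comm mem)
  have group: "group G"
  proof (rule groupI)
    show "\<exists>y\<in>carrier G. y \<otimes>\<^bsub>G\<^esub> x = \<one>\<^bsub>G\<^esub>" if "x \<in> carrier G" for x
      using right_division[OF that one_closed] by auto
  qed (simp_all add: assoc)
  interpret group G by (fact group)
  \<comment> \<open>Natural powers multiply by \<open>a\<close> on the right, so the values come
    from \<open>b \<otimes> a = c\<close> and \<open>c \<otimes> a = d\<close>. They exhaust the
    carrier, which makes \<open>a\<close> a generator.\<close>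
  have pow: "a [^]\<^bsub>G\<^esub> (0::int) = \<one>\<^bsub>G\<^esub>" "a [^]\<^bsub>G\<^esub> (1::int) = a" "a [^]\<^bsub>G\<^esub> (2::int) = b"
    "a [^]\<^bsub>G\<^esub> (3::int) = c" "a [^]\<^bsub>G\<^esub> (4::int) = d"
    using mem by (simp_all add: table comm int_pow_def nat_pow_def numeral_eq_Suc)
  have "carrier G = range (\<lambda>n::int. a [^]\<^bsub>G\<^esub> n)"
  proof
    show "carrier G \<subseteq> range (\<lambda>n::int. a [^]\<^bsub>G\<^esub> n)"
      unfolding C using pow by (metis insert_subset empty_subsetI rangeI)
  qed (use mem in auto)
  then have "cyclic_group G"
    using mem cyclic_group by blast
  with group show ?thesis by blast
qed

end
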